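(* Let $n$ be a positive integer, let $S_0$ be an additively idempotent semiring, let $S = Diag_n(S_0)$ be the semiring of diagonal $n\times n$ matrices with entries from $S_0$, let $P(S) = \{\sum_{i=1}^n \varepsilon_i E_{ii} \mid \varepsilon_i \in\{0,1\},\ i=1,\dots,n\}$ be its subsemiring of patterns of matrices of $S$, and let $D(S)$ be the semiring of the inner derivations $\delta_X : S\to S$, $\delta_X(A) = A\,P_X$, where $P_X$ ranges over $P(S)$. Then: a) The zero of $D(S)$ is the derivation $\delta_0 = 0$. The unit element of $D(S)$ is the identity map $\delta_E = i$. b) $\delta_X^2 = \delta_X$ for any $\delta_X\in D(S)$. c) $\delta_X\delta_Y = \delta_Y\delta_X$ for any $\delta_X,\delta_Y\in D(S)$. d) $\delta_{E_{ii}}\,\delta_{E_{jj}} = 0$ if $i\neq j$. e) For $\delta_X,\delta_Y\in D(S)$: $\delta_X+\delta_Y = 0 \iff \delta_X=\delta_Y=0$, and $\delta_X\,\delta_Y = i \iff \delta_X=\delta_Y=i$. f) The sets $I_X = \{\delta_Y \in D(S) \mid P_Y \text{ is a submatrix of } P_X\}$, for $P_X\in P(S)$, are all the ideals of the semiring $D(S)$. The minimal ideals of $D(S)$ are $I_{E_{ii}}$, and the maximal ideals of $D(S)$ are $I_{E-E_{ii}}$, where $i=1,\dots,n$. g) If $\delta$ is an arbitrary (not necessarily inner) derivation of the semiring $S$, then for all $i=1,\dots,n$ one has $\delta(E_{ii}) = \alpha_i E_{ii}$ for some $\alpha_i\in S_0$.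
   Context: A semiring $(S,+,\cdot)$ has commutative associative addition, associative multiplication, and two-sided distributivity; all semirings are assumed to have a zero $0$ (with $a+0=a$, $a0=0a=0$) and an identity $1$; multiplication need not be commutative. A semiring is additively idempotent if $a+a=a$ for all $a$. A derivation of a semiring $S$ is a map $\delta:S\to S$ with $\delta(a+b)=\delta(a)+\delta(b)$ and $\delta(ab)=\delta(a)b+a\delta(b)$ for all $a,b\in S$. $E$ is the identity matrix and $E_{ij}$ are the matrix units. The pattern $P_A=(p_{ij})$ of a matrix $A=(a_{ij})$ is the matrix with $p_{ij}=1$ if $a_{ij}\ne 0$ and $p_{ij}=0$ if $a_{ij}=0$. For $(0,1)$-matrices, $P_B$ is called a submatrix of $P_A$ if whenever the $(i,j)$ entry of $P_B$ is $1$, the $(i,j)$ entry of $P_A$ is also $1$. The symbol $E-E_{ii}$ denotes $\sum_{j\neq i}E_{jj}$. The maps $\delta_X$ are derivations of $S$; the operations on $D(S)$ are $\delta_X+\delta_Y=\delta_{X+Y}$ and $\delta_X\delta_Y=\delta_{XY}$, which makes $D(S)$ a semiring isomorphic to $P(S)$. Here $i$ (without index) denotes the identity map $S\to S$. An ideal of a semiring $R$ is a nonempty subset closed under addition and under left and right multiplication by elements of $R$; "minimal" means minimal among nonzero ideals and "maximal" means maximal among proper ideals. *)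

theory Defs
  imports "HOL-Analysis.Finite_Cartesian_Product" "HOL-Algebra.Ring"
begin

section \<open>Derivations and ideals of semirings\<close>

definition semiring_derivation ::
    "('a, 'm) ring_scheme \<Rightarrow> ('a \<Rightarrow> 'a) \<Rightarrow> bool" where
  "semiring_derivation R d \<longleftrightarrow> d \<in> carrier R \<rightarrow> carrier R \<and>
     (\<forall>a\<in>carrier R. \<forall>b\<in>carrier R.
        d (a \<oplus>\<^bsub>R\<^esub> b) = d a \<oplus>\<^bsub>R\<^esub> d b \<and>
        d (a \<otimes>\<^bsub>R\<^esub> b) = (d a \<otimes>\<^bsub>R\<^esub> b) \<oplus>\<^bsub>R\<^esub> (a \<otimes>\<^bsub>R\<^esub> d b))"

text \<open>The \<open>ideal\<close> locale of \<open>HOL-Algebra\<close> is for rings only (it requires additive subgroups).\<close>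

definition semiring_ideal :: "'a set \<Rightarrow> ('a, 'm) ring_scheme \<Rightarrow> bool" where
  "semiring_ideal I R \<longleftrightarrow> I \<subseteq> carrier R \<and> I \<noteq> {} \<and>
     (\<forall>a\<in>I. \<forall>b\<in>I. a \<oplus>\<^bsub>R\<^esub> b \<in> I) \<and>
     (\<forall>a\<in>I. \<forall>r\<in>carrier R. r \<otimes>\<^bsub>R\<^esub> a \<in> I \<and> a \<otimes>\<^bsub>R\<^esub> r \<in> I)"

definition minimal_semiring_ideal :: "'a set \<Rightarrow> ('a, 'm) ring_scheme \<Rightarrow> bool" where
  "minimal_semiring_ideal I R \<longleftrightarrow> semiring_ideal I R \<and> I \<noteq> {\<zero>\<^bsub>R\<^esub>} \<and>
     (\<forall>J. semiring_ideal J R \<and> J \<noteq> {\<zero>\<^bsub>R\<^esub>} \<and> J \<subseteq> I \<longrightarrow> J = I)"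

definition maximal_semiring_ideal :: "'a set \<Rightarrow> ('a, 'm) ring_scheme \<Rightarrow> bool" where
  "maximal_semiring_ideal I R \<longleftrightarrow> semiring_ideal I R \<and> I \<noteq> carrier R \<and>
     (\<forall>J. semiring_ideal J R \<and> J \<noteq> carrier R \<and> I \<subseteq> J \<longrightarrow> J = I)"


section \<open>Diagonal matrices and patterns\<close>

text \<open>The library defines \<open>1 :: 'a ^ 'n ^ 'n\<close> to be the all-ones matrix, so the
  identity matrix is \<^term>\<open>mat 1\<close>.\<close>

definition Diag :: "('a::semiring_1 ^ 'n ^ 'n) ring" where
  "Diag = \<lparr>carrier = {A. \<forall>i j. i \<noteq> j \<longrightarrow> A $ i $ j = 0},
           monoid.mult = (**), one = mat 1, zero = 0, add = (+)\<rparr>"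

definition matrix_unit :: "'n \<Rightarrow> 'n \<Rightarrow> 'a::semiring_1 ^ 'n ^ 'n" where
  "matrix_unit i j = (\<chi> k l. if k = i \<and> l = j then 1 else 0)"

definition scale_matrix :: "'a::semiring_1 \<Rightarrow> 'a ^ 'n ^ 'm \<Rightarrow> 'a ^ 'n ^ 'm" where
  "scale_matrix c A = (\<chi> i j. c * A $ i $ j)"

definition pattern :: "'a::semiring_1 ^ 'n ^ 'n \<Rightarrow> 'a ^ 'n ^ 'n" where
  "pattern A = (\<chi> i j. if A $ i $ j \<noteq> 0 then 1 else 0)"

definition submatrix_of :: "'a::semiring_1 ^ 'n ^ 'n \<Rightarrow> 'a ^ 'n ^ 'n \<Rightarrow> bool" where
  "submatrix_of B A \<longleftrightarrow> (\<forall>i j. B $ i $ j = 1 \<longrightarrow> A $ i $ j = 1)"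

definition diag_patterns :: "('a::semiring_1 ^ 'n ^ 'n) set" where
  "diag_patterns =
     {\<Sum>i\<in>UNIV. scale_matrix (\<epsilon> i) (matrix_unit i i) |\<epsilon>. \<forall>i. \<epsilon> i \<in> {0, 1}}"


section \<open>The semiring of inner derivations\<close>

text \<open>Maps on the carrier of \<^const>\<open>Diag\<close> are represented as extensional functions, so that
  equality of maps is equality of HOL functions.\<close>

definition inner_der ::
    "'a::semiring_1 ^ 'n ^ 'n \<Rightarrow> ('a ^ 'n ^ 'n \<Rightarrow> 'a ^ 'n ^ 'n)" where
  "inner_der X = (\<lambda>A\<in>carrier Diag. A ** pattern X)"

text \<open>Sum and product of maps are the pointwise sum and the composition; by
  \<open>inner_der_add\<close> and \<open>inner_der_mult\<close> below they send the derivations given by \<open>X\<close> and \<open>Y\<close>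
  to the ones given by \<open>X + Y\<close> and \<open>X ** Y\<close>.\<close>

definition inner_ders :: "('a::semiring_1 ^ 'n ^ 'n \<Rightarrow> 'a ^ 'n ^ 'n) ring" where
  "inner_ders = \<lparr>carrier = {inner_der X |X. pattern X \<in> diag_patterns},
     monoid.mult = (\<lambda>f g. compose (carrier Diag) f g), one = (\<lambda>A\<in>carrier Diag. A),
     zero = (\<lambda>A\<in>carrier Diag. 0), add = (\<lambda>f g. \<lambda>A\<in>carrier Diag. f A + g A)\<rparr>"

definition pattern_ideal ::
    "'a::semiring_1 ^ 'n ^ 'n \<Rightarrow> ('a ^ 'n ^ 'n \<Rightarrow> 'a ^ 'n ^ 'n) set" where
  "pattern_ideal X =
     {inner_der Y |Y. pattern Y \<in> diag_patterns \<and> submatrix_of (pattern Y) (pattern X)}"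


section \<open>Basic properties\<close>

lemma carrier_Diag: "A \<in> carrier Diag \<longleftrightarrow> (\<forall>i j. i \<noteq> j \<longrightarrow> A $ i $ j = 0)"
  by (simp add: Diag_def)

lemma Diag_simps [simp]:
  "A \<otimes>\<^bsub>Diag\<^esub> B = A ** B" "A \<oplus>\<^bsub>Diag\<^esub> B = A + B" "\<one>\<^bsub>Diag\<^esub> = mat 1" "\<zero>\<^bsub>Diag\<^esub> = 0"
  by (simp_all add: Diag_def)

lemma diag_mult_nth:
  assumes "A \<in> carrier Diag"
  shows "(A ** B) $ i $ j = A $ i $ i * B $ i $ j"
proof -
  have "(A ** B) $ i $ j = (\<Sum>k\<in>UNIV. A $ i $ k * B $ k $ j)"
    by (simp add: matrix_matrix_mult_def)
  also have "\<dots> = (\<Sum>k\<in>UNIV. if k = i then A $ i $ i * B $ i $ j else 0)"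
    using assms by (intro sum.cong) (auto simp: carrier_Diag)
  finally show ?thesis by simp
qed

lemma diag_mult_closed:
  "A \<in> carrier Diag \<Longrightarrow> B \<in> carrier Diag \<Longrightarrow> A ** B \<in> carrier Diag"
  by (simp add: carrier_Diag [of "A ** B"] diag_mult_nth) (simp add: carrier_Diag)

lemma mult_add_distrib_right: "(A + B) ** (C :: 'a::semiring_1 ^ 'n ^ 'n) = A ** C + B ** C"
  by (simp add: matrix_matrix_mult_def vec_eq_iff distrib_right sum.distrib)

lemma mult_add_distrib_left: "(C :: 'a::semiring_1 ^ 'n ^ 'n) ** (A + B) = C ** A + C ** B"
  by (simp add: matrix_matrix_mult_def vec_eq_iff distrib_left sum.distrib)

lemma Diag_closed:
  "0 \<in> carrier Diag" "mat 1 \<in> carrier Diag"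
  "A \<in> carrier Diag \<Longrightarrow> B \<in> carrier Diag \<Longrightarrow> A + B \<in> carrier Diag"
  by (simp_all add: carrier_Diag mat_def)

theorem semiring_Diag: "semiring (Diag :: ('a::semiring_1 ^ 'n ^ 'n) ring)"
proof (intro semiring.intro semiring_axioms.intro abelian_monoidI monoidI)
qed (simp_all add: diag_mult_closed Diag_closed matrix_mul_assoc
      mult_add_distrib_left mult_add_distrib_right, simp_all add: add_ac)

lemma diag_patterns_iff:
  fixes X :: "'a::semiring_1 ^ 'n ^ 'n"
  shows "X \<in> diag_patterns \<longleftrightarrow> X \<in> carrier Diag \<and> (\<forall>i. X $ i $ i \<in> {0, 1})"
proof -
  have *: "(\<Sum>i\<in>UNIV. scale_matrix (\<epsilon> i) (matrix_unit i i)) = (\<chi> k l. if k = l then \<epsilon> k else 0)"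
    for \<epsilon> :: "'n \<Rightarrow> 'a"
  proof -
    have "(\<Sum>i\<in>UNIV. scale_matrix (\<epsilon> i) (matrix_unit i i) $ k $ l) =
        (\<Sum>i\<in>UNIV. if i = k then if k = l then \<epsilon> k else 0 else 0)" for k l
      by (intro sum.cong) (auto simp: scale_matrix_def matrix_unit_def)
    then show ?thesis
      by (simp add: vec_eq_iff)
  qed
  show ?thesis
  proof
    assume "X \<in> diag_patterns"
    then show "X \<in> carrier Diag \<and> (\<forall>i. X $ i $ i \<in> {0, 1})"
      by (auto simp: diag_patterns_def * carrier_Diag)
  next
    assume X: "X \<in> carrier Diag \<and> (\<forall>i. X $ i $ i \<in> {0, 1})"
    then have "X = (\<chi> k l. if k = l then X $ k $ k else 0)"
      by (simp add: vec_eq_iff carrier_Diag)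
    with X show "X \<in> diag_patterns"
      unfolding diag_patterns_def * by (intro CollectI exI [of _ "\<lambda>k. X $ k $ k"]) simp
  qed
qed

lemma pattern_mem_iff: "pattern X \<in> diag_patterns \<longleftrightarrow> X \<in> carrier Diag"
proof -
  have "(\<forall>i. pattern X $ i $ i \<in> {0, 1})" and "pattern X $ i $ j = 0 \<longleftrightarrow> X $ i $ j = 0" for i j
    by (simp_all add: pattern_def)
  then show ?thesis
    by (simp only: diag_patterns_iff carrier_Diag simp_thms)
qed

lemma pattern_ident:
  assumes "X \<in> diag_patterns" shows "pattern X = X"
proof -
  have "(if X $ i $ j \<noteq> 0 then 1 else 0) = X $ i $ j" for i j
    using assms by (cases "i = j") (auto simp: diag_patterns_iff carrier_Diag)
  then show ?thesis by (simp add: pattern_def vec_eq_iff)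
qed

lemma diag_patterns_subset: "X \<in> diag_patterns \<Longrightarrow> X \<in> carrier Diag"
  by (simp add: diag_patterns_iff)

lemma diag_patterns_closed:
  fixes X Y :: "'a::semiring_1 ^ 'n ^ 'n"
  assumes idem: "\<forall>a::'a. a + a = a" and XY: "X \<in> diag_patterns" "Y \<in> diag_patterns"
  shows "X + Y \<in> diag_patterns" "X ** Y \<in> diag_patterns"
proof -
  have one: "(1::'a) + 1 = 1" using idem by blast
  have "X $ i $ i \<in> {0, 1}" "Y $ i $ i \<in> {0, 1}" for i
    using XY by (simp_all only: diag_patterns_iff)
  then have "X $ i $ i + Y $ i $ i \<in> {0, 1}" "X $ i $ i * Y $ i $ i \<in> {0, 1}" for i
    by (metis insert_iff one add_0 add_0_right singletonD,
        metis insert_iff mult_1 mult_zero_left singletonD)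
  then show "X + Y \<in> diag_patterns" "X ** Y \<in> diag_patterns"
    using XY unfolding diag_patterns_iff
    by (simp_all add: Diag_closed diag_mult_closed diag_mult_nth)
qed

lemma diag_patterns_0_1: "0 \<in> diag_patterns" "mat 1 \<in> diag_patterns"
  by (simp_all add: diag_patterns_iff carrier_Diag mat_def)

lemma diag_patterns_commute:
  fixes X A :: "'a::semiring_1 ^ 'n ^ 'n"
  assumes "X \<in> diag_patterns" "A \<in> carrier Diag"
  shows "A ** X = X ** A"
proof -
  have "A $ i $ i * X $ i $ j = X $ i $ i * A $ i $ j" for i j
  proof (cases "i = j")
    case True
    have "X $ i $ i = 0 \<or> X $ i $ i = 1" using assms by (simp add: diag_patterns_iff)
    with True show ?thesis by auto
  qed (use assms in \<open>simp add: diag_patterns_iff carrier_Diag\<close>)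
  then show ?thesis
    using assms by (simp add: vec_eq_iff diag_mult_nth diag_patterns_subset)
qed

lemma add_idem_matrix:
  fixes A :: "'a::semiring_1 ^ 'n ^ 'n"
  assumes "\<forall>a::'a. a + a = a" shows "A + A = A"
  using assms by (simp add: vec_eq_iff)

theorem inner_der_derivation:
  fixes X :: "'a::semiring_1 ^ 'n ^ 'n"
  assumes idem: "\<forall>a::'a. a + a = a" and X: "pattern X \<in> diag_patterns"
  shows "semiring_derivation Diag (inner_der X)"
proof -
  have "A ** B ** pattern X = A ** pattern X ** B + A ** (B ** pattern X)"
    if "A \<in> carrier Diag" "B \<in> carrier Diag" for A B
  proof -
    have "A ** pattern X ** B = A ** B ** pattern X"
      using diag_patterns_commute [OF X that(2)] by (simp add: matrix_mul_assoc [symmetric])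
    then show ?thesis
      by (simp add: matrix_mul_assoc add_idem_matrix [OF idem])
  qed
  then show ?thesis
    using X by (auto simp: semiring_derivation_def inner_der_def diag_mult_closed Diag_closed
        diag_patterns_subset mult_add_distrib_right)
qed

lemma inner_ders_simps [simp]:
  "f \<otimes>\<^bsub>inner_ders\<^esub> g = compose (carrier Diag) f g"
  "f \<oplus>\<^bsub>inner_ders\<^esub> g = (\<lambda>A\<in>carrier Diag. f A + g A)"
  "\<one>\<^bsub>inner_ders\<^esub> = (\<lambda>A\<in>carrier Diag. A)"
  "\<zero>\<^bsub>inner_ders\<^esub> = (\<lambda>A\<in>carrier Diag. 0)"
  by (simp_all add: inner_ders_def)

lemma carrier_inner_ders:
  "carrier (inner_ders :: ('a::semiring_1 ^ 'n ^ 'n \<Rightarrow> 'a ^ 'n ^ 'n) ring) =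
     inner_der ` diag_patterns"
proof -
  have *: "inner_der X = inner_der (pattern X)" if "pattern X \<in> diag_patterns"
    for X :: "'a ^ 'n ^ 'n"
    using pattern_ident [OF that] by (simp add: inner_der_def)
  have "{inner_der X |X :: 'a ^ 'n ^ 'n. pattern X \<in> diag_patterns} = inner_der ` diag_patterns"
    unfolding image_def by (intro Collect_cong) (metis * pattern_ident)
  then show ?thesis
    by (simp add: inner_ders_def)
qed

theorem inner_der_inject:
  assumes XY: "X \<in> diag_patterns" "Y \<in> diag_patterns" and eq: "inner_der X = inner_der Y"
  shows "X = Y"
  using fun_cong [OF eq, of "mat 1"] XY by (simp add: inner_der_def Diag_closed pattern_ident)

theorem inner_der_add:
  fixes X Y :: "'a::semiring_1 ^ 'n ^ 'n"
  assumes "\<forall>a::'a. a + a = a" "X \<in> diag_patterns" "Y \<in> diag_patterns"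
  shows "inner_der X \<oplus>\<^bsub>inner_ders\<^esub> inner_der Y = inner_der (X + Y)"
  using diag_patterns_closed [OF assms] assms
  by (auto simp: inner_der_def pattern_ident mult_add_distrib_left)

theorem inner_der_mult:
  fixes X Y :: "'a::semiring_1 ^ 'n ^ 'n"
  assumes "\<forall>a::'a. a + a = a" "X \<in> diag_patterns" "Y \<in> diag_patterns"
  shows "inner_der X \<otimes>\<^bsub>inner_ders\<^esub> inner_der Y = inner_der (X ** Y)"
  using diag_patterns_closed [OF assms] assms diag_patterns_commute [of X Y]
  by (auto simp: inner_der_def pattern_ident compose_def diag_mult_closed diag_patterns_subset
      matrix_mul_assoc [symmetric])

lemma inner_der_0_1:
  "\<zero>\<^bsub>inner_ders\<^esub> = inner_der 0" "\<one>\<^bsub>inner_ders\<^esub> = inner_der (mat 1)"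
  by (auto simp: inner_der_def pattern_ident diag_patterns_0_1)

theorem semiring_inner_ders:
  assumes idem: "\<forall>a::'a::semiring_1. a + a = a"
  shows "semiring (inner_ders :: ('a ^ 'n ^ 'n \<Rightarrow> 'a ^ 'n ^ 'n) ring)"
proof -
  note closed = diag_patterns_closed [OF idem]
  note simps = inner_der_add [OF idem] inner_der_mult [OF idem] inner_der_0_1
    closed diag_patterns_0_1 imageI
  show ?thesis
    by (intro semiring.intro semiring_axioms.intro abelian_monoidI monoidI;
        unfold carrier_inner_ders; (elim imageE)?;
        simp add: simps add_ac matrix_mul_assoc mult_add_distrib_left mult_add_distrib_right
          del: inner_ders_simps)
qed

end

theory Submission
  imports Defs
begin

text \<open>
  A diagonal pattern is determined by the set of indices of its nonzero diagonal entries, and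
  additive idempotency turns sum and product of patterns into union and intersection of these
  sets. So \<open>D(S)\<close> is the Boolean lattice of subsets of the index set: its ideals are the
  nonempty sets of subsets closed under union and intersection with arbitrary subsets, hence, by
  finiteness, the principal ones \<open>Pow U\<close>. For the last claim apply the Leibniz rule to the
  idempotents \<open>E\<^sub>i\<^sub>i\<close>.
\<close>

section \<open>Diagonal patterns encoded as index sets\<close>

definition diag_of_set :: "'n set \<Rightarrow> 'a::semiring_1 ^ 'n ^ 'n" where
  "diag_of_set T = (\<chi> i j. if i = j \<and> i \<in> T then 1 else 0)"

definition set_der :: "'n set \<Rightarrow> ('a::semiring_1 ^ 'n ^ 'n \<Rightarrow> 'a ^ 'n ^ 'n)" where
  "set_der T = inner_der (diag_of_set T)"

lemma diag_of_set_nth: "diag_of_set T $ i $ j = (if i = j \<and> i \<in> T then 1 else 0)"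
  by (simp add: diag_of_set_def)

lemma diag_of_set_in_patterns [simp]: "diag_of_set T \<in> diag_patterns"
  by (simp add: diag_patterns_iff carrier_Diag diag_of_set_nth)

text \<open>The set can be read off the diagonal because \<open>0 \<noteq> 1\<close> in the class
  \<open>semiring_1\<close>.\<close>

lemma diag_of_set_inject [simp]:
  "(diag_of_set T :: 'a::semiring_1 ^ 'n ^ 'n) = diag_of_set U \<longleftrightarrow> T = U"
  by (auto simp: vec_eq_iff diag_of_set_nth split: if_splits)

lemma diag_patterns_eq_range: "diag_patterns = range diag_of_set"
proof (intro equalityI subsetI)
  fix X :: "'a::semiring_1 ^ 'n ^ 'n"
  assume X: "X \<in> diag_patterns"
  then have "X $ i $ i = 0 \<or> X $ i $ i = 1" for i
    by (simp add: diag_patterns_iff)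
  with X have "X = diag_of_set {i. X $ i $ i = 1}"
    by (force simp: vec_eq_iff diag_of_set_nth diag_patterns_iff carrier_Diag)
  then show "X \<in> range diag_of_set" by blast
qed auto

text \<open>At an index lying in both sets the sum has the entry \<open>1 + 1\<close>, which
  idempotency collapses to \<open>1\<close>; this is why addition is union rather than
  counting.\<close>

lemma diag_of_set_add:
  assumes "\<forall>a::'a::semiring_1. a + a = a"
  shows "diag_of_set T + diag_of_set U = (diag_of_set (T \<union> U) :: 'a ^ 'n ^ 'n)"
  using assms by (auto simp: vec_eq_iff diag_of_set_nth)

lemma diag_of_set_mult:
  "diag_of_set T ** diag_of_set U = (diag_of_set (T \<inter> U) :: 'a::semiring_1 ^ 'n ^ 'n)"
  by (simp add: vec_eq_iff diag_of_set_nth diag_mult_nth diag_patterns_subset)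

lemma diag_of_set_simps:
  "0 = diag_of_set {}" "mat 1 = diag_of_set UNIV" "matrix_unit i i = diag_of_set {i}"
  by (auto simp: vec_eq_iff diag_of_set_nth mat_def matrix_unit_def)

text \<open>With \<open>T = UNIV - {i}\<close> this identifies the matrix E - E_ii, which is by
  definition such a sum, as the pattern of a complement.\<close>

lemma sum_matrix_unit: "(\<Sum>j\<in>T. matrix_unit j j) = diag_of_set T"
proof -
  have "(\<Sum>j\<in>T. matrix_unit j j $ k $ l :: 'a::semiring_1) =
      (\<Sum>j\<in>T. if k = j then if k = l then 1 else 0 else 0)" for k l
    by (intro sum.cong) (auto simp: matrix_unit_def)
  then show ?thesis
    by (simp add: vec_eq_iff diag_of_set_nth)
qed

section \<open>The semiring of inner derivations as a lattice of index sets\<close>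

lemma carrier_inner_ders_range: "carrier inner_ders = range set_der"
  by (auto simp: carrier_inner_ders diag_patterns_eq_range set_der_def)

text \<open>Evaluating the derivation at the identity matrix recovers its pattern. Equations between
  inner derivations thereby become equations between sets.\<close>

lemma set_der_inject: "(set_der T :: 'a::semiring_1 ^ 'n ^ 'n \<Rightarrow> _) = set_der U \<longleftrightarrow> T = U"
  by (metis set_der_def inner_der_inject diag_of_set_in_patterns diag_of_set_inject)

lemma inj_set_der: "inj set_der"
  by (simp add: inj_def set_der_inject)

lemma set_der_add:
  assumes "\<forall>a::'a::semiring_1. a + a = a"
  shows "(set_der T :: 'a ^ 'n ^ 'n \<Rightarrow> _) \<oplus>\<^bsub>inner_ders\<^esub> set_der U = set_der (T \<union> U)"
  \<comment> \<open>Here and below \<open>inner_ders_simps\<close> is switched off, since it would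
    unfold the operations into pointwise sums and compositions before the algebraic rules could
    match.\<close>
  using assms by (simp add: set_der_def inner_der_add diag_of_set_add del: inner_ders_simps)

lemma set_der_mult:
  assumes "\<forall>a::'a::semiring_1. a + a = a"
  shows "(set_der T :: 'a ^ 'n ^ 'n \<Rightarrow> _) \<otimes>\<^bsub>inner_ders\<^esub> set_der U = set_der (T \<inter> U)"
  using assms by (simp add: set_der_def inner_der_mult diag_of_set_mult del: inner_ders_simps)

lemma set_der_0_1: "\<zero>\<^bsub>inner_ders\<^esub> = set_der {}" "\<one>\<^bsub>inner_ders\<^esub> = set_der UNIV"
  by (simp_all add: set_der_def inner_der_0_1 diag_of_set_simps(2) flip: diag_of_set_simps(1)
      del: inner_ders_simps)

section \<open>Classification of the ideals\<close>

lemma pattern_ideal_diag_of_set: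
  "pattern_ideal (diag_of_set U :: 'a::semiring_1 ^ 'n ^ 'n) = set_der ` Pow U"
proof -
  have sub: "submatrix_of (diag_of_set T :: 'a ^ 'n ^ 'n) (diag_of_set U) \<longleftrightarrow> T \<subseteq> U"
    for T
    by (auto simp: submatrix_of_def diag_of_set_nth)
  have "inner_der Y \<in> (set_der ` Pow U :: ('a ^ 'n ^ 'n \<Rightarrow> _) set)"
    if Y: "pattern Y \<in> diag_patterns" "submatrix_of (pattern Y) (diag_of_set U)"
    for Y :: "'a ^ 'n ^ 'n"
  proof -
    obtain T where T: "pattern Y = diag_of_set T"
      using Y(1) by (auto simp: diag_patterns_eq_range)
    \<comment> \<open>\<open>inner_der\<close> sees its argument only through
      \<open>pattern\<close>, so an arbitrary diagonal \<open>Y\<close> may be replaced by its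
      pattern.\<close>
    have "inner_der Y = set_der T"
      using T by (simp add: inner_der_def set_der_def pattern_ident)
    then show ?thesis
      using Y(2) sub T by auto
  qed
  moreover have "set_der T \<in> pattern_ideal (diag_of_set U :: 'a ^ 'n ^ 'n)" if "T \<subseteq> U" for T
    unfolding pattern_ideal_def set_der_def
    using that by (intro CollectI exI [of _ "diag_of_set T"]) (simp add: pattern_ident sub)
  ultimately show ?thesis
    by (auto simp: pattern_ideal_def pattern_ident)
qed

text \<open>\<open>pattern_ideal X\<close> depends only on the pattern of \<open>X\<close>, so
  letting \<open>X\<close> range over the matrices of the form \<open>diag_of_set U\<close> already
  gives every such ideal.\<close>

lemma pattern_ideals_eq_range:
  "{pattern_ideal X |X :: 'a::semiring_1 ^ 'n ^ 'n. pattern X \<in> diag_patterns} =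
     range (\<lambda>U. set_der ` Pow U)"
proof (intro equalityI subsetI)
  fix I assume "I \<in> {pattern_ideal X |X :: 'a ^ 'n ^ 'n. pattern X \<in> diag_patterns}"
  then obtain X :: "'a ^ 'n ^ 'n"
    where X: "pattern X \<in> diag_patterns" and I: "I = pattern_ideal X"
    by blast
  obtain U where U: "pattern X = diag_of_set U"
    using X by (auto simp: diag_patterns_eq_range)
  have "I = pattern_ideal (diag_of_set U)"
    using U by (simp add: I pattern_ideal_def pattern_ident)
  then show "I \<in> range (\<lambda>U. set_der ` Pow U)"
    by (simp add: pattern_ideal_diag_of_set)
next
  fix I assume "I \<in> range (\<lambda>U. set_der ` Pow U :: ('a ^ 'n ^ 'n \<Rightarrow> _) set)"
  then obtain U where "I = pattern_ideal (diag_of_set U :: 'a ^ 'n ^ 'n)"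
    unfolding pattern_ideal_diag_of_set by blast
  then show "I \<in> {pattern_ideal X |X :: 'a ^ 'n ^ 'n. pattern X \<in> diag_patterns}"
    by (intro CollectI exI [of _ "diag_of_set U"]) (simp add: pattern_ident)
qed

text \<open>Supplies the largest member of a union-closed family, by induction over its finite
  nonempty subfamilies.\<close>

lemma finite_Union_closed_mem:
  assumes "finite J" "J \<noteq> {}" "\<And>T U. T \<in> J \<Longrightarrow> U \<in> J \<Longrightarrow> T \<union> U \<in> J"
  shows "\<Union>J \<in> J"
proof -
  have "\<Union>K \<in> J" if "finite K" "K \<noteq> {}" "K \<subseteq> J" for K
    using that by (induction rule: finite_ne_induct) (auto intro: assms(3))
  then show ?thesis using assms(1,2) by blast
qed

lemma semiring_ideal_iff:
  fixes I :: "('a::semiring_1 ^ 'n ^ 'n \<Rightarrow> 'a ^ 'n ^ 'n) set"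
  assumes idem: "\<forall>a::'a. a + a = a"
  shows "semiring_ideal I inner_ders \<longleftrightarrow> I \<in> range (\<lambda>U. set_der ` Pow U)"
proof
  assume I: "semiring_ideal I inner_ders"
  \<comment> \<open>Since \<open>set_der\<close> maps onto the carrier, nothing of the ideal is lost
    by passing to its family of index sets.\<close>
  define J where "J = set_der -` I"
  have IJ: "I = set_der ` J"
    using I by (auto simp: semiring_ideal_def carrier_inner_ders_range J_def)
  have "J \<noteq> {}"
    using I IJ by (auto simp: semiring_ideal_def)
  moreover have "T \<union> U \<in> J" if "T \<in> J" "U \<in> J" for T U
    using I that unfolding J_def
    by (simp add: semiring_ideal_def flip: set_der_add [OF idem] del: inner_ders_simps)
  \<comment> \<open>The family is finite because the index type is; its union is the generator of
    the ideal.\<close>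
  ultimately have top: "\<Union>J \<in> J"
    by (intro finite_Union_closed_mem) auto
  have "T \<inter> U \<in> J" if "T \<in> J" for T U
    using I that unfolding J_def
    by (simp add: semiring_ideal_def carrier_inner_ders_range
        flip: set_der_mult [OF idem] del: inner_ders_simps)
  \<comment> \<open>A subset \<open>U\<close> equals \<open>\<Union>J \<inter> U\<close>, a product
    of the generator with an element of the semiring.\<close>
  then have "U \<in> J" if "U \<subseteq> \<Union>J" for U
    using top that by (metis inf.absorb_iff2)
  then have "J = Pow (\<Union>J)" by blast
  with IJ show "I \<in> range (\<lambda>U. set_der ` Pow U)" by blast
next
  assume "I \<in> range (\<lambda>U. set_der ` Pow U)"
  then obtain U where I: "I = set_der ` Pow U" by blast
  have "T \<union> T' \<in> Pow U" "T \<inter> V \<in> Pow U" "V \<inter> T \<in> Pow U"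
    if "T \<in> Pow U" "T' \<in> Pow U" for T T' V
    using that by auto
  then show "semiring_ideal I inner_ders"
    by (auto simp: I semiring_ideal_def carrier_inner_ders_range set_der_add [OF idem]
        set_der_mult [OF idem] simp del: inner_ders_simps)
qed

text \<open>By injectivity of \<open>set_der\<close>, the map from \<open>U\<close> to its ideal is
  an order embedding; the zero ideal and the whole carrier are the images of \<open>{}\<close> and
  \<open>UNIV\<close>.\<close>

lemma image_Pow_simps:
  "(set_der ` Pow U :: ('a::semiring_1 ^ 'n ^ 'n \<Rightarrow> _) set) \<subseteq> set_der ` Pow V \<longleftrightarrow> U \<subseteq> V"
  "(set_der ` Pow U :: ('a ^ 'n ^ 'n \<Rightarrow> _) set) = set_der ` Pow V \<longleftrightarrow> U = V"
  "(set_der ` Pow U :: ('a ^ 'n ^ 'n \<Rightarrow> _) set) = {\<zero>\<^bsub>inner_ders\<^esub>} \<longleftrightarrow> U = {}"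
  "(set_der ` Pow U :: ('a ^ 'n ^ 'n \<Rightarrow> _) set) = carrier inner_ders \<longleftrightarrow> U = UNIV"
proof -
  have sub: "(set_der ` Pow U :: ('a ^ 'n ^ 'n \<Rightarrow> _) set) \<subseteq> set_der ` Pow V \<longleftrightarrow> U \<subseteq> V"
    for U V
    unfolding inj_image_subset_iff [OF inj_set_der] by blast
  have eq: "(set_der ` Pow U :: ('a ^ 'n ^ 'n \<Rightarrow> _) set) = set_der ` Pow V \<longleftrightarrow> U = V" for U V
    by (simp only: set_eq_subset sub)
  have "{\<zero>\<^bsub>inner_ders\<^esub>} = (set_der ` Pow {} :: ('a ^ 'n ^ 'n \<Rightarrow> _) set)"
    and "carrier inner_ders = (set_der ` Pow UNIV :: ('a ^ 'n ^ 'n \<Rightarrow> _) set)"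
    by (simp_all add: set_der_0_1 carrier_inner_ders_range del: inner_ders_simps)
  then show
    "(set_der ` Pow U :: ('a ^ 'n ^ 'n \<Rightarrow> _) set) = {\<zero>\<^bsub>inner_ders\<^esub>} \<longleftrightarrow> U = {}"
    "(set_der ` Pow U :: ('a ^ 'n ^ 'n \<Rightarrow> _) set) = carrier inner_ders \<longleftrightarrow> U = UNIV"
    by (simp_all only: eq)
  show
    "(set_der ` Pow U :: ('a ^ 'n ^ 'n \<Rightarrow> _) set) \<subseteq> set_der ` Pow V \<longleftrightarrow> U \<subseteq> V"
    "(set_der ` Pow U :: ('a ^ 'n ^ 'n \<Rightarrow> _) set) = set_der ` Pow V \<longleftrightarrow> U = V"
    by (rule sub eq)+
qed

section \<open>Minimal and maximal ideals\<close>

lemma all_range_iff: "(\<forall>J. J \<in> range f \<and> P J \<longrightarrow> Q J) \<longleftrightarrow> (\<forall>V. P (f V) \<longrightarrow> Q (f V))"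
  by blast

lemma minimal_nonempty_set_iff:
  "U \<noteq> {} \<and> (\<forall>V. V \<noteq> {} \<and> V \<subseteq> U \<longrightarrow> V = U) \<longleftrightarrow> (\<exists>i. U = {i})"
proof
  assume U: "U \<noteq> {} \<and> (\<forall>V. V \<noteq> {} \<and> V \<subseteq> U \<longrightarrow> V = U)"
  then obtain i where "i \<in> U" by blast
  then have "{i} \<noteq> {} \<and> {i} \<subseteq> U" by blast
  then have "{i} = U" by (rule U [THEN conjunct2, THEN spec, THEN mp])
  then show "\<exists>i. U = {i}" by blast
qed blast

lemma maximal_proper_set_iff:
  "U \<noteq> UNIV \<and> (\<forall>V. V \<noteq> UNIV \<and> U \<subseteq> V \<longrightarrow> V = U) \<longleftrightarrow> (\<exists>i. U = UNIV - {i})"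
proof
  assume U: "U \<noteq> UNIV \<and> (\<forall>V. V \<noteq> UNIV \<and> U \<subseteq> V \<longrightarrow> V = U)"
  then obtain i where "i \<notin> U" by blast
  then have "UNIV - {i} \<noteq> UNIV \<and> U \<subseteq> UNIV - {i}" by blast
  then have "UNIV - {i} = U" by (rule U [THEN conjunct2, THEN spec, THEN mp])
  then show "\<exists>i. U = UNIV - {i}" by blast
qed blast

lemma minimal_semiring_ideal_iff:
  fixes I :: "('a::semiring_1 ^ 'n ^ 'n \<Rightarrow> 'a ^ 'n ^ 'n) set"
  assumes idem: "\<forall>a::'a. a + a = a"
  shows "minimal_semiring_ideal I inner_ders \<longleftrightarrow> (\<exists>i. I = set_der ` Pow {i})"
proof -
  have iff: "minimal_semiring_ideal (set_der ` Pow U :: ('a ^ 'n ^ 'n \<Rightarrow> _) set) inner_ders \<longleftrightarrow>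
      (\<exists>i. U = {i})" for U
    \<comment> \<open>Quantification over ideals becomes quantification over index sets, so that
      minimality turns literally into the left side of
      \<open>minimal_nonempty_set_iff\<close>.\<close>
    unfolding minimal_semiring_ideal_def semiring_ideal_iff [OF idem] all_range_iff
      image_Pow_simps minimal_nonempty_set_iff [symmetric]
    by blast
  show ?thesis
  proof
    assume min: "minimal_semiring_ideal I inner_ders"
    then obtain U where I: "I = set_der ` Pow U"
      unfolding minimal_semiring_ideal_def semiring_ideal_iff [OF idem] by blast
    have "\<exists>i. U = {i}"
      using min unfolding I iff .
    then show "\<exists>i. I = set_der ` Pow {i}"
      unfolding I by blast
  next
    assume "\<exists>i. I = set_der ` Pow {i}"
    then show "minimal_semiring_ideal I inner_ders"
      by (elim exE) (simp only: iff, blast)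
  qed
qed

lemma maximal_semiring_ideal_iff:
  fixes I :: "('a::semiring_1 ^ 'n ^ 'n \<Rightarrow> 'a ^ 'n ^ 'n) set"
  assumes idem: "\<forall>a::'a. a + a = a"
  shows "maximal_semiring_ideal I inner_ders \<longleftrightarrow> (\<exists>i. I = set_der ` Pow (UNIV - {i}))"
proof -
  have iff: "maximal_semiring_ideal (set_der ` Pow U :: ('a ^ 'n ^ 'n \<Rightarrow> _) set) inner_ders \<longleftrightarrow>
      (\<exists>i. U = UNIV - {i})" for U
    unfolding maximal_semiring_ideal_def semiring_ideal_iff [OF idem] all_range_iff
      image_Pow_simps maximal_proper_set_iff [symmetric]
    by blast
  show ?thesis
  proof
    assume max: "maximal_semiring_ideal I inner_ders"
    then obtain U where I: "I = set_der ` Pow U"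
      unfolding maximal_semiring_ideal_def semiring_ideal_iff [OF idem] by blast
    have "\<exists>i. U = UNIV - {i}"
      using max unfolding I iff .
    then show "\<exists>i. I = set_der ` Pow (UNIV - {i})"
      unfolding I by blast
  next
    assume "\<exists>i. I = set_der ` Pow (UNIV - {i})"
    then show "maximal_semiring_ideal I inner_ders"
      by (elim exE) (simp only: iff, blast)
  qed
qed

section \<open>Arbitrary derivations on the diagonal matrix units\<close>

lemma derivation_matrix_unit:
  fixes \<delta> :: "'a::semiring_1 ^ 'n ^ 'n \<Rightarrow> 'a ^ 'n ^ 'n"
  assumes der: "semiring_derivation Diag \<delta>"
  shows "\<exists>\<alpha>. \<delta> (matrix_unit i i) = scale_matrix \<alpha> (matrix_unit i i)"
proof -
  define e :: "'a ^ 'n ^ 'n" where "e = matrix_unit i i"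
  define d where "d = \<delta> e"
  have e_nth: "e $ j $ k = (if j = i \<and> k = i then 1 else 0)" for j k
    by (simp add: e_def matrix_unit_def)
  have e: "e \<in> carrier Diag"
    by (simp add: carrier_Diag e_nth)
  with der have d: "d \<in> carrier Diag"
    by (auto simp: semiring_derivation_def d_def)
  have "e ** e = e"
    by (simp add: e_def diag_of_set_simps(3) diag_of_set_mult)
  moreover have "\<delta> (e ** e) = d ** e + e ** d"
    using der e by (simp add: semiring_derivation_def d_def)
  ultimately have "d $ j $ j = (d ** e + e ** d) $ j $ j" for j
    by (simp add: d_def)
  then have "d $ j $ j = d $ j $ j * e $ j $ j + e $ j $ j * d $ j $ j" for j
    by (simp only: vector_add_component diag_mult_nth [OF d] diag_mult_nth [OF e])
  then have "d $ j $ j = 0" if "j \<noteq> i" for j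
    \<comment> \<open>Both summands contain the factor \<open>e $ j $ j = 0\<close>. The equation is
      chained by \<open>trans\<close> because as a rewrite rule it would loop: its left side recurs
      on the right.\<close>
    by (rule trans) (use that in \<open>simp add: e_nth\<close>)
  then have "d $ j $ k = d $ i $ i * e $ j $ k" for j k
    using d by (cases "j = k") (auto simp: e_nth carrier_Diag)
  \<comment> \<open>The coefficient is the only entry of \<open>d\<close> that can be
    nonzero.\<close>
  then have "d = scale_matrix (d $ i $ i) e"
    unfolding vec_eq_iff scale_matrix_def vec_lambda_beta by blast
  then show ?thesis
    unfolding d_def e_def by (rule exI)
qed

theorem theorem1:
  fixes S :: "('a::semiring_1 ^ 'n ^ 'n) ring"
    and D :: "('a ^ 'n ^ 'n \<Rightarrow> 'a ^ 'n ^ 'n) ring"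
  assumes idem: "\<forall>a::'a. a + a = a"
    and S: "S = Diag"
    and D: "D = inner_ders"
  shows
    "(inner_der 0 \<in> carrier D \<and> inner_der 0 = (\<lambda>A\<in>carrier S. 0) \<and> inner_der 0 = \<zero>\<^bsub>D\<^esub> \<and>
     (\<forall>d\<in>carrier D. d \<oplus>\<^bsub>D\<^esub> inner_der 0 = d \<and> inner_der 0 \<oplus>\<^bsub>D\<^esub> d = d \<and>
        d \<otimes>\<^bsub>D\<^esub> inner_der 0 = inner_der 0 \<and> inner_der 0 \<otimes>\<^bsub>D\<^esub> d = inner_der 0) \<and>
     inner_der (mat 1) \<in> carrier D \<and> inner_der (mat 1) = (\<lambda>A\<in>carrier S. A) \<and>
     inner_der (mat 1) = \<one>\<^bsub>D\<^esub> \<and>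
     (\<forall>d\<in>carrier D. d \<otimes>\<^bsub>D\<^esub> inner_der (mat 1) = d \<and> inner_der (mat 1) \<otimes>\<^bsub>D\<^esub> d = d)) \<and>
     (\<forall>d\<in>carrier D. d [^]\<^bsub>D\<^esub> (2::nat) = d) \<and>
     (\<forall>d\<in>carrier D. \<forall>e\<in>carrier D. d \<otimes>\<^bsub>D\<^esub> e = e \<otimes>\<^bsub>D\<^esub> d) \<and>
     (\<forall>i j :: 'n. i \<noteq> j \<longrightarrow>
       inner_der (matrix_unit i i) \<otimes>\<^bsub>D\<^esub> inner_der (matrix_unit j j) = \<zero>\<^bsub>D\<^esub>) \<and>
     (\<forall>d\<in>carrier D. \<forall>e\<in>carrier D.
       (d \<oplus>\<^bsub>D\<^esub> e = \<zero>\<^bsub>D\<^esub> \<longleftrightarrow> d = \<zero>\<^bsub>D\<^esub> \<and> e = \<zero>\<^bsub>D\<^esub>) \<and>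
       (d \<otimes>\<^bsub>D\<^esub> e = \<one>\<^bsub>D\<^esub> \<longleftrightarrow> d = \<one>\<^bsub>D\<^esub> \<and> e = \<one>\<^bsub>D\<^esub>)) \<and>
     ({I. semiring_ideal I D} =
       {pattern_ideal X |X :: 'a ^ 'n ^ 'n. pattern X \<in> diag_patterns}) \<and>
     ({I. minimal_semiring_ideal I D} =
       {pattern_ideal (matrix_unit i i) |i :: 'n. True}) \<and>
     ({I. maximal_semiring_ideal I D} =
       {pattern_ideal (\<Sum>j\<in>UNIV - {i}. matrix_unit j j) |i :: 'n. True}) \<and>
     (\<forall>\<delta>. semiring_derivation S \<delta> \<longrightarrow>
       (\<forall>i. \<exists>\<alpha>. \<delta> (matrix_unit i i) = scale_matrix \<alpha> (matrix_unit i i)))"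
proof -
  interpret D: semiring D
    unfolding D by (rule semiring_inner_ders [OF idem])
  have zero: "inner_der 0 = \<zero>\<^bsub>D\<^esub>" and one: "inner_der (mat 1) = \<one>\<^bsub>D\<^esub>"
    by (simp_all add: D inner_der_0_1 del: inner_ders_simps)
  have fun_eqs: "\<zero>\<^bsub>D\<^esub> = (\<lambda>A\<in>carrier S. 0)" "\<one>\<^bsub>D\<^esub> = (\<lambda>A\<in>carrier S. A)"
    by (simp_all add: D S)
  have "d \<otimes>\<^bsub>D\<^esub> d = d" if "d \<in> carrier D" for d
    using that by (auto simp: D carrier_inner_ders_range set_der_mult [OF idem]
        simp del: inner_ders_simps)
  then have sq: "d [^]\<^bsub>D\<^esub> (2::nat) = d" if "d \<in> carrier D" for d
    \<comment> \<open>Writing \<open>2\<close> as a double successor lets the recursive power unfold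
      to the product of \<open>d\<close> with itself.\<close>
    using that by (simp add: numeral_2_eq_2)
  have comm: "d \<otimes>\<^bsub>D\<^esub> e = e \<otimes>\<^bsub>D\<^esub> d" if "d \<in> carrier D" "e \<in> carrier D" for d e
    using that by (auto simp: D carrier_inner_ders_range set_der_mult [OF idem] Int_commute
        simp del: inner_ders_simps)
  have orth: "inner_der (matrix_unit i i) \<otimes>\<^bsub>D\<^esub> inner_der (matrix_unit j j) = \<zero>\<^bsub>D\<^esub>"
    if "i \<noteq> j" for i j :: 'n
    using that by (simp add: D diag_of_set_simps(3) set_der_mult [OF idem] set_der_0_1
        flip: set_der_def del: inner_ders_simps)
  have zero_one_iff: "(d \<oplus>\<^bsub>D\<^esub> e = \<zero>\<^bsub>D\<^esub> \<longleftrightarrow> d = \<zero>\<^bsub>D\<^esub> \<and> e = \<zero>\<^bsub>D\<^esub>) \<and>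
      (d \<otimes>\<^bsub>D\<^esub> e = \<one>\<^bsub>D\<^esub> \<longleftrightarrow> d = \<one>\<^bsub>D\<^esub> \<and> e = \<one>\<^bsub>D\<^esub>)" if "d \<in> carrier D" "e \<in> carrier D" for d e
    using that by (auto simp: D carrier_inner_ders_range set_der_add [OF idem]
        set_der_mult [OF idem] set_der_0_1 set_der_inject simp del: inner_ders_simps)
  have ideals: "{I. semiring_ideal I D} =
      {pattern_ideal X |X :: 'a ^ 'n ^ 'n. pattern X \<in> diag_patterns}"
    by (simp add: D semiring_ideal_iff [OF idem] pattern_ideals_eq_range)
  have minimal: "{I. minimal_semiring_ideal I D} = {pattern_ideal (matrix_unit i i) |i :: 'n. True}"
    by (simp add: D minimal_semiring_ideal_iff [OF idem] diag_of_set_simps(3)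
        pattern_ideal_diag_of_set)
  have maximal: "{I. maximal_semiring_ideal I D} =
      {pattern_ideal (\<Sum>j\<in>UNIV - {i}. matrix_unit j j) |i :: 'n. True}"
    by (simp add: D maximal_semiring_ideal_iff [OF idem] sum_matrix_unit pattern_ideal_diag_of_set)
  have der: "\<exists>\<alpha>. \<delta> (matrix_unit i i) = scale_matrix \<alpha> (matrix_unit i i)"
    if "semiring_derivation S \<delta>" for \<delta> i
    using that derivation_matrix_unit by (simp add: S)
  show ?thesis
    \<comment> \<open>Once both derivations are the constants of \<open>D\<close>, their neutrality
      and absorption laws are instances of the semiring axioms.\<close>
    unfolding zero one
    by (intro conjI ballI allI impI; (fact fun_eqs ideals minimal maximal)?)
      (simp_all only: sq orth zero_one_iff der comm D.zero_closed D.one_closed D.l_zero D.r_zero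
        D.l_null D.r_null D.l_one D.r_one simp_thms)
qed

end
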